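(* Let $D\subset\mathbb{R}$ be open, let $z\in D$ be a simple zero of a function $f:D\to\mathbb{R}$ that is sufficiently smooth in a neighborhood of $z$, let $k\ge0$ be a fixed integer, let $h$ be a step function at $z$ (of index $k$), and let $U_k(x)=\mathbf a=(a_0,a_1,\ldots,a_k)\in\mathbb{R}^{k+1}$ be a constant vectorial function. Put $$V_k(x)=\bigl(f^{(1)}(x),\,f^{(1)}(x+h(x)),\,\ldots,\,f^{(1)}(x+k\,h(x))\bigr),$$ $$\phi_k(x)=\langle U_k(x),V_k(x)\rangle=a_0f^{(1)}(x)+a_1f^{(1)}(x+h(x))+\cdots+a_kf^{(1)}(x+k\,h(x)).$$ Let $D_k=\operatorname{diag}\bigl(f^{(1)}(z),f^{(2)}(z),\ldots,f^{(k+1)}(z)\bigr)$ and let $R_k$ be the $(k+1)\times(k+1)$ matrix $$R_k=\begin{bmatrix}1&1&1&1&\cdots&1\\1&0&-1&-2&\cdots&-(k-1)\\1&0&1&2^2&\cdots&(k-1)^2\\ \vdots&\vdots&\vdots&\vdots&&\vdots\\1&0&(-1)^k&(-1)^k2^k&\cdots&(-1)^k(k-1)^k\end{bmatrix},$$ that is, with rows $r=0,\ldots,k$ and columns $i=0,\ldots,k$, the entry in position $(r,i)$ is $(1-i)^r$ (with $0^0=1$). Then the $(k+1)\times(k+1)$ matrix whose rows are $V_k^{(0)}(z),V_k^{(1)}(z),\ldots,V_k^{(k)}(z)$ equals $D_kR_k$. Furthermore: (i) The function $\phi_k$ is a model function (of index $k$) if and only if $U_k=\mathbf a=(a_0,a_1,\ldots,a_k)$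 is the (unique) solution of the linear system $$R_k\,\mathbf a=\mathbf b,\qquad \mathbf b=\bigl(1,1/2,1/3,\ldots,1/(k+1)\bigr).$$ Also, this solution satisfies $\sum_{i=0}^k a_i=1$. (ii) If $f^{(i)}(z)\neq0$ for $i=1,\ldots,k$, then $U_k=\mathbf a$ represents the (normalized) barycentric coordinates of the model function $\phi_k$ relative to the basis $$\mathcal V_k=\bigl\{f^{(1)}(x),\ f^{(1)}(x+h(x)),\ \ldots,\ f^{(1)}(x+k\,h(x))\bigr\}.$$ Moreover, for the model function $\phi_k$ (that is, with $\mathbf a$ the solution of $R_k\mathbf a=\mathbf b$), the iterative process generated by $t_k(x)=x-[\phi_k(x)]^{-1}f(x)$ has order of convergence at least $k+2$.
   Context: Notation: $g^{(i)}$ is the $i$-th derivative of $g$ (componentwise for vector-valued functions), with $g^{(0)}=g$; $[\,\cdot\,]^{-1}$ applied to a real value denotes the reciprocal; $\langle\cdot,\cdot\rangle$ is the Euclidean inner product. A zero $z$ of $f$ is simple if $f(z)=0$ and $f^{(1)}(z)\ne0$. "Sufficiently smooth" means having as many continuous derivatives near $z$ as needed. All functions are considered in a sufficiently small neighborhood of $z$. Step function (of index $k$) at $z$: a function $h$, sufficiently smooth in a neighborhood of $z$, with $h(z)=0$, $h^{(1)}(z)=-1$, and $h^{(i)}(z)=0$ for $i=2,3,\ldots,k$. Model function (of index $k$): a function $\phi$, sufficiently smooth in a neighborhood of $z$, with $\phi^{(i)}(z)=\dfrac{f^{(i+1)}(z)}{i+1}$ for $i=0,1,\ldots,k$. Normalized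 barycentric coordinates: coefficients of $\phi_k$ in the basis $\mathcal V_k$ of the span of its elements, with sum equal to $1$. Order of convergence: an iterative map $t$ with fixed point $z$ has order of convergence $p\ge 1$ if there is a constant $c>0$ with $\lim_{x\to z}|z-t(x)|/|z-x|^p=c$. The order of convergence is local, at $z$; "at least $q$" is understood as $|t(x)-z|=O(|x-z|^{q})$ as $x\to z$.
   Formalization: In (i), "only if" is stated under f^{(i)}(z)≠0 for i=1,…,k+1, and (ii) assumes this for i=1,…,k+1 rather than i=1,…,k; both fail as printed for k=1, z=0, f(x)=x, h(x)=−x, a=(1,0). *)

theory Defs
  imports
    "HOL-Analysis.Derivative"
    "HOL-Library.Landau_Symbols"
    "Jordan_Normal_Form.Matrix"
begin

no_notation inner (infix \<open>\<bullet>\<close> 70)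

text \<open>
  Vectors and matrices are those of \<^theory>\<open>Jordan_Normal_Form.Matrix\<close>, indexed from 0, and
  the i-th derivative of g is written \<^term>\<open>(deriv ^^ i) g\<close>.  A real function defined only
  near z is represented by any total extension: every notion below depends only on the values
  in arbitrarily small neighbourhoods of z.
\<close>

text \<open>n times continuously differentiable in some neighbourhood of z.\<close>

definition smooth_near :: "nat \<Rightarrow> (real \<Rightarrow> real) \<Rightarrow> real \<Rightarrow> bool" where
  "smooth_near n g z \<longleftrightarrow>
     (\<exists>S. open S \<and> z \<in> S \<and>
          (\<forall>i<n. \<forall>x\<in>S. (deriv ^^ i) g differentiable (at x)) \<and>
          continuous_on S ((deriv ^^ n) g))"

definition simple_zero :: "(real \<Rightarrow> real) \<Rightarrow> real \<Rightarrow> bool" where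
  "simple_zero f z \<longleftrightarrow> f z = 0 \<and> deriv f z \<noteq> 0"

text \<open>
  For index k, the smoothness needed of step and model functions is \<open>C\<^sup>k\<^sup>+\<^sup>1\<close>: one derivative
  more than is prescribed at z, so that the Taylor remainder has order k + 1.
  Correspondingly f itself, whose derivative enters the model function, is taken \<open>C\<^sup>k\<^sup>+\<^sup>2\<close>.
\<close>

definition step_function :: "nat \<Rightarrow> (real \<Rightarrow> real) \<Rightarrow> real \<Rightarrow> bool" where
  "step_function k h z \<longleftrightarrow>
     smooth_near (k + 1) h z \<and> h z = 0 \<and> deriv h z = -1 \<and>
     (\<forall>i\<in>{2..k}. (deriv ^^ i) h z = 0)"

definition model_function ::
    "nat \<Rightarrow> (real \<Rightarrow> real) \<Rightarrow> (real \<Rightarrow> real) \<Rightarrow> real \<Rightarrow> bool" where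
  "model_function k f \<phi> z \<longleftrightarrow>
     smooth_near (k + 1) \<phi> z \<and>
     (\<forall>i\<le>k. (deriv ^^ i) \<phi> z = (deriv ^^ (i + 1)) f z / real (i + 1))"

definition V_vec :: "(real \<Rightarrow> real) \<Rightarrow> (real \<Rightarrow> real) \<Rightarrow> nat \<Rightarrow> real \<Rightarrow> real vec" where
  "V_vec f h k x = vec (k + 1) (\<lambda>i. deriv f (x + real i * h x))"

definition phi ::
    "(real \<Rightarrow> real) \<Rightarrow> (real \<Rightarrow> real) \<Rightarrow> nat \<Rightarrow> (real \<Rightarrow> real vec) \<Rightarrow> real \<Rightarrow> real" where
  "phi f h k U x = U x \<bullet> V_vec f h k x"

definition vec_deriv :: "nat \<Rightarrow> (real \<Rightarrow> real vec) \<Rightarrow> real \<Rightarrow> real vec" where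
  "vec_deriv r g x = vec (dim_vec (g x)) (\<lambda>i. (deriv ^^ r) (\<lambda>y. g y $ i) x)"

definition D_mat :: "(real \<Rightarrow> real) \<Rightarrow> real \<Rightarrow> nat \<Rightarrow> real mat" where
  "D_mat f z k = mat_diag (k + 1) (\<lambda>r. (deriv ^^ (r + 1)) f z)"

definition R_mat :: "nat \<Rightarrow> real mat" where
  "R_mat k = mat (k + 1) (k + 1) (\<lambda>(r, i). (1 - real i) ^ r)"

definition b_vec :: "nat \<Rightarrow> real vec" where
  "b_vec k = vec (k + 1) (\<lambda>r. 1 / real (r + 1))"

text \<open>
  Linear independence and coordinates are those of germs at z: identities between functions are
  required only in some neighbourhood of z, which may depend on the coefficients.  In
  particular, a family independent in this sense is independent on every neighbourhood of z.
\<close>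

definition lin_indep_near :: "(real \<Rightarrow> real vec) \<Rightarrow> nat \<Rightarrow> real \<Rightarrow> bool" where
  "lin_indep_near V n z \<longleftrightarrow>
     (\<forall>c \<in> carrier_vec n. (\<forall>\<^sub>F x in nhds z. (\<Sum>i<n. c $ i * V x $ i) = 0) \<longrightarrow> c = 0\<^sub>v n)"

definition barycentric_coordinates ::
    "real vec \<Rightarrow> (real \<Rightarrow> real) \<Rightarrow> (real \<Rightarrow> real vec) \<Rightarrow> nat \<Rightarrow> real \<Rightarrow> bool" where
  "barycentric_coordinates a \<phi> V n z \<longleftrightarrow>
     a \<in> carrier_vec n \<and> lin_indep_near V n z \<and>
     (\<forall>\<^sub>F x in nhds z. \<phi> x = (\<Sum>i<n. a $ i * V x $ i)) \<and>
     (\<Sum>i<n. a $ i) = 1"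

definition convergence_order_at_least :: "(real \<Rightarrow> real) \<Rightarrow> real \<Rightarrow> nat \<Rightarrow> bool" where
  "convergence_order_at_least t z q \<longleftrightarrow>
     t z = z \<and> (\<lambda>x. \<bar>t x - z\<bar>) \<in> O[at z](\<lambda>x. \<bar>x - z\<bar> ^ q)"

end

theory Submission
  imports Defs "Jordan_Normal_Form.Determinant"
begin

text \<open>
  Near z the function x + i h(x) agrees with an affine function of slope 1 - i up to order k, so
  in the r-th derivative of f'(x + i h(x)) at z only the term f^(r+1)(z) (1 - i)^r survives: this
  is the factorisation D R, with R a Vandermonde matrix in the distinct nodes 1 - i.  For the
  order of convergence, the model condition says exactly that (x - z) times the Taylor polynomial
  of degree k of the model function is the Taylor polynomial of degree k + 1 of f, so that
  t(x) - z is a remainder of order k + 2 divided by a function that does not vanish at z.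
\<close>

section \<open>Closure properties of germs of class C^n\<close>

text \<open>Only finitely many derivatives are involved, so the common open set of the definition
  can be traded for separate conditions holding eventually near \<open>z\<close>; later proofs then
  need no explicit neighbourhoods.\<close>

lemma smooth_near_iff:
  "smooth_near n g z \<longleftrightarrow>
     (\<forall>i<n. \<forall>\<^sub>F x in nhds z. (deriv ^^ i) g differentiable (at x)) \<and>
     (\<forall>\<^sub>F x in nhds z. isCont ((deriv ^^ n) g) x)"
proof
  assume "smooth_near n g z"
  then show "(\<forall>i<n. \<forall>\<^sub>F x in nhds z. (deriv ^^ i) g differentiable (at x)) \<and>
     (\<forall>\<^sub>F x in nhds z. isCont ((deriv ^^ n) g) x)"
    unfolding smooth_near_def eventually_nhds
    by (metis continuous_on_eq_continuous_at)
next
  assume R: "(\<forall>i<n. \<forall>\<^sub>F x in nhds z. (deriv ^^ i) g differentiable (at x)) \<and>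
     (\<forall>\<^sub>F x in nhds z. isCont ((deriv ^^ n) g) x)"
  then have "\<forall>\<^sub>F x in nhds z. \<forall>i\<in>{..<n}. (deriv ^^ i) g differentiable (at x)"
    by (intro eventually_ball_finite) auto
  with R have "\<forall>\<^sub>F x in nhds z.
      (\<forall>i\<in>{..<n}. (deriv ^^ i) g differentiable (at x)) \<and> isCont ((deriv ^^ n) g) x"
    by (simp add: eventually_conj_iff)
  then obtain S where S: "open S" "z \<in> S"
    and "\<forall>x\<in>S. (\<forall>i\<in>{..<n}. (deriv ^^ i) g differentiable (at x)) \<and> isCont ((deriv ^^ n) g) x"
    unfolding eventually_nhds by blast
  then show "smooth_near n g z"
    unfolding smooth_near_def
    by (intro exI[of _ S]) (auto intro!: continuous_at_imp_continuous_on)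
qed

lemma smooth_near_0: "smooth_near 0 g z \<longleftrightarrow> (\<forall>\<^sub>F x in nhds z. isCont g x)"
  by (simp add: smooth_near_iff)

text \<open>The recursion behind the inductions below. The innermost derivative is split off, so the
  induction passes from \<open>g\<close> to \<open>deriv g\<close>; hence
  \<open>funpow_Suc_right\<close> replaces the default unfolding of \<open>funpow\<close>.\<close>

lemma smooth_near_Suc:
  "smooth_near (Suc n) g z \<longleftrightarrow>
     (\<forall>\<^sub>F x in nhds z. (g has_real_derivative deriv g x) (at x)) \<and> smooth_near n (deriv g) z"
  by (auto simp: smooth_near_iff All_less_Suc2 DERIV_deriv_iff_real_differentiable
      funpow_Suc_right simp del: funpow.simps(2))

lemma smooth_near_SucD:
  assumes "smooth_near (Suc n) g z"
  shows "\<forall>\<^sub>F x in nhds z. (g has_real_derivative deriv g x) (at x)" and "smooth_near n (deriv g) z"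
  using assms by (simp_all add: smooth_near_Suc)

lemma smooth_near_cong:
  assumes "\<forall>\<^sub>F x in nhds z. g x = g' x"
  shows "smooth_near n g z \<longleftrightarrow> smooth_near n g' z"
proof -
  \<comment> \<open>Differentiability and continuity at \<open>x\<close> depend on the germ at
    \<open>x\<close>, so agreement near \<open>z\<close> is first turned into agreement near each
    \<open>x\<close> close to \<open>z\<close>.\<close>
  have ev: "\<forall>\<^sub>F x in nhds z. \<forall>\<^sub>F y in nhds x. g y = g' y"
    using assms by (simp add: eventually_eventually)
  have *: "\<forall>\<^sub>F x in nhds z. \<forall>\<^sub>F y in nhds x. (deriv ^^ i) g y = (deriv ^^ i) g' y" for i
    unfolding eventually_eventually using ev by eventually_elim (rule higher_deriv_cong_ev, auto)
  have "(\<forall>\<^sub>F x in nhds z. (deriv ^^ i) g differentiable (at x)) \<longleftrightarrow>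
        (\<forall>\<^sub>F x in nhds z. (deriv ^^ i) g' differentiable (at x))" for i
    using *[of i]
    by (rule eventually_cong) (simp add: real_differentiable_def DERIV_cong_ev[OF refl _ refl])
  moreover have "(\<forall>\<^sub>F x in nhds z. isCont ((deriv ^^ n) g) x) \<longleftrightarrow>
        (\<forall>\<^sub>F x in nhds z. isCont ((deriv ^^ n) g') x)"
    using *[of n] by (rule eventually_cong) (rule isCont_cong)
  ultimately show ?thesis by (simp add: smooth_near_iff)
qed

text \<open>Allows an explicit formula \<open>g'\<close> from the sum, product or chain rule in
  place of the opaque \<open>deriv g\<close>.\<close>

lemma smooth_near_SucI:
  assumes "\<forall>\<^sub>F x in nhds z. (g has_real_derivative g' x) (at x)" and "smooth_near n g' z"
  shows "smooth_near (Suc n) g z"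
proof -
  have "\<forall>\<^sub>F x in nhds z. deriv g x = g' x"
    using assms(1) by eventually_elim (rule DERIV_imp_deriv)
  then have "smooth_near n (deriv g) z" and "\<forall>\<^sub>F x in nhds z. (g has_real_derivative deriv g x) (at x)"
    using assms smooth_near_cong[of "deriv g" g' z n] by (auto elim: eventually_elim2)
  then show ?thesis by (simp add: smooth_near_Suc)
qed

text \<open>The same replacement of \<open>deriv g\<close> by a formula, now for values of higher
  derivatives at \<open>z\<close>.\<close>

lemma higher_deriv_Suc_ev:
  assumes "\<forall>\<^sub>F x in nhds z. (g has_real_derivative g' x) (at x)"
  shows "(deriv ^^ Suc n) g z = (deriv ^^ n) g' z"
proof -
  have "\<forall>\<^sub>F x in nhds z. deriv g x = g' x"
    using assms by eventually_elim (rule DERIV_imp_deriv)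
  then have "(deriv ^^ n) (deriv g) z = (deriv ^^ n) g' z"
    by (rule higher_deriv_cong_ev) simp
  then show ?thesis
    by (simp add: funpow_Suc_right del: funpow.simps(2))
qed

lemma smooth_near_Suc_imp: "smooth_near (Suc n) g z \<Longrightarrow> smooth_near n g z"
proof (induction n arbitrary: g)
  case 0
  then show ?case
    by (auto simp: smooth_near_Suc smooth_near_0 elim!: eventually_mono intro: DERIV_isCont)
qed (simp add: smooth_near_Suc)

lemma smooth_near_mono: "smooth_near n g z \<Longrightarrow> m \<le> n \<Longrightarrow> smooth_near m g z"
  by (induction n) (auto simp: le_Suc_eq dest: smooth_near_Suc_imp)

lemma smooth_near_isCont: "smooth_near n g z \<Longrightarrow> isCont g z"
  using smooth_near_mono[of n g z 0]
  by (auto simp: smooth_near_0 dest: eventually_nhds_x_imp_x)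

lemma smooth_near_const: "smooth_near n (\<lambda>x. c) z"
  by (induction n arbitrary: c)
    (auto simp: smooth_near_0 intro: smooth_near_SucI[where g' = "\<lambda>x. 0"])

lemma smooth_near_ident: "smooth_near n (\<lambda>x. x) z"
  by (cases n)
    (auto simp: smooth_near_0 intro: smooth_near_SucI[where g' = "\<lambda>x. 1"] smooth_near_const)

lemma smooth_near_add:
  "smooth_near n u z \<Longrightarrow> smooth_near n w z \<Longrightarrow> smooth_near n (\<lambda>x. u x + w x) z"
proof (induction n arbitrary: u w)
  case 0
  then show ?case by (auto simp: smooth_near_0 elim: eventually_elim2)
next
  case (Suc n)
  show ?case
  proof (rule smooth_near_SucI)
    show "\<forall>\<^sub>F x in nhds z. ((\<lambda>x. u x + w x) has_real_derivative deriv u x + deriv w x) (at x)"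
      using Suc.prems[THEN smooth_near_SucD(1)] by eventually_elim (intro derivative_intros)
    show "smooth_near n (\<lambda>x. deriv u x + deriv w x) z"
      using Suc.prems[THEN smooth_near_SucD(2)] by (rule Suc.IH)
  qed
qed

lemma smooth_near_mult:
  "smooth_near n u z \<Longrightarrow> smooth_near n w z \<Longrightarrow> smooth_near n (\<lambda>x. u x * w x) z"
proof (induction n arbitrary: u w)
  case 0
  then show ?case by (auto simp: smooth_near_0 elim: eventually_elim2)
next
  case (Suc n)
  show ?case
  proof (rule smooth_near_SucI)
    show "\<forall>\<^sub>F x in nhds z. ((\<lambda>x. u x * w x) has_real_derivative
        (deriv u x * w x + u x * deriv w x)) (at x)"
      using Suc.prems[THEN smooth_near_SucD(1)]
      by eventually_elim (auto intro!: derivative_eq_intros)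
    show "smooth_near n (\<lambda>x. deriv u x * w x + u x * deriv w x) z"
      using Suc.prems
      by (intro smooth_near_add Suc.IH) (auto intro: smooth_near_Suc_imp smooth_near_SucD)
  qed
qed

lemma smooth_near_sum:
  "finite I \<Longrightarrow> (\<And>i. i \<in> I \<Longrightarrow> smooth_near n (u i) z) \<Longrightarrow>
     smooth_near n (\<lambda>x. \<Sum>i\<in>I. u i x) z"
  by (induction rule: finite_induct) (auto intro: smooth_near_const smooth_near_add)

text \<open>The chain rule turns \<open>F\<close> into \<open>deriv F\<close> and leaves the inner
  \<open>g\<close> unchanged, so the induction generalises over \<open>F\<close> alone. Continuity
  of \<open>g\<close> at \<open>z\<close> pulls properties valid near \<open>g z\<close> back to
  points near \<open>z\<close>.\<close>

lemma smooth_near_compose: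
  "smooth_near n F (g z) \<Longrightarrow> smooth_near n g z \<Longrightarrow> smooth_near n (\<lambda>x. F (g x)) z"
proof (induction n arbitrary: F)
  case 0
  have "filterlim g (nhds (g z)) (nhds z)"
    using smooth_near_isCont[OF 0(2)] by (simp add: isCont_def tendsto_at_iff_tendsto_nhds)
  then have "\<forall>\<^sub>F x in nhds z. isCont F (g x)"
    using 0(1) by (auto simp: smooth_near_0 filterlim_iff)
  with 0(2) show ?case
    unfolding smooth_near_0 by eventually_elim (rule isCont_o2)
next
  case (Suc n)
  have "filterlim g (nhds (g z)) (nhds z)"
    using smooth_near_isCont[OF Suc.prems(2)] by (simp add: isCont_def tendsto_at_iff_tendsto_nhds)
  then have F: "\<forall>\<^sub>F x in nhds z. (F has_real_derivative deriv F (g x)) (at (g x))"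
    using Suc.prems(1) by (auto simp: smooth_near_Suc filterlim_iff)
  show ?case
  proof (rule smooth_near_SucI)
    show "\<forall>\<^sub>F x in nhds z. ((\<lambda>x. F (g x)) has_real_derivative deriv F (g x) * deriv g x) (at x)"
      using F smooth_near_SucD(1)[OF Suc.prems(2)] by eventually_elim (rule DERIV_chain2)
    show "smooth_near n (\<lambda>x. deriv F (g x) * deriv g x) z"
      using Suc.IH[OF smooth_near_SucD(2)[OF Suc.prems(1)] smooth_near_Suc_imp[OF Suc.prems(2)]]
        smooth_near_SucD(2)[OF Suc.prems(2)] by (rule smooth_near_mult)
  qed
qed

section \<open>Higher derivatives of sums, products and compositions at a point\<close>

lemma higher_deriv_const: "(deriv ^^ n) (\<lambda>x. c) z = (if n = 0 then c else (0::real))"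
proof -
  have "(deriv ^^ n) (\<lambda>x. 0::real) = (\<lambda>x. 0)" for n
    by (induction n) auto
  then show ?thesis
    by (cases n) (auto simp: funpow_Suc_right simp del: funpow.simps(2))
qed

lemma higher_deriv_add:
  "smooth_near n u z \<Longrightarrow> smooth_near n w z \<Longrightarrow>
     (deriv ^^ n) (\<lambda>x. u x + w x) z = (deriv ^^ n) u z + (deriv ^^ n) w z"
proof (induction n arbitrary: u w)
  case (Suc n)
  have "(deriv ^^ Suc n) (\<lambda>x. u x + w x) z = (deriv ^^ n) (\<lambda>x. deriv u x + deriv w x) z"
  proof (rule higher_deriv_Suc_ev)
    show "\<forall>\<^sub>F x in nhds z. ((\<lambda>x. u x + w x) has_real_derivative deriv u x + deriv w x) (at x)"
      using Suc.prems[THEN smooth_near_SucD(1)] by eventually_elim (intro derivative_intros)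
  qed
  also have "\<dots> = (deriv ^^ n) (deriv u) z + (deriv ^^ n) (deriv w) z"
    using Suc.prems by (intro Suc.IH) (auto simp: smooth_near_Suc)
  finally show ?case by (simp add: funpow_Suc_right del: funpow.simps(2))
qed simp

text \<open>In the formula of Leibniz every term that differentiates \<open>w\<close> vanishes at
  \<open>z\<close>. Induction with the ordinary product rule gives this without the binomial
  expansion.\<close>

lemma higher_deriv_mult_flat:
  "smooth_near n u z \<Longrightarrow> smooth_near n w z \<Longrightarrow> (\<And>j. j \<in> {1..n} \<Longrightarrow> (deriv ^^ j) w z = 0) \<Longrightarrow>
     (deriv ^^ n) (\<lambda>x. u x * w x) z = (deriv ^^ n) u z * w z"
proof (induction n arbitrary: u w)
  case (Suc n)
  have sm: "smooth_near n u z" "smooth_near n w z" "smooth_near n (deriv u) z"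
    "smooth_near n (deriv w) z"
    using Suc.prems smooth_near_Suc_imp[of n] by (simp_all add: smooth_near_Suc)
  \<comment> \<open>Flatness of \<open>deriv w\<close> concerns orders from 1 on; the additional
    order 0 makes the contribution of \<open>u * deriv w\<close> vanish.\<close>
  have w': "(deriv ^^ j) (deriv w) z = 0" if "j \<le> n" for j
    using Suc.prems(3)[of "Suc j"] that by (simp add: funpow_Suc_right del: funpow.simps(2))
  have "(deriv ^^ Suc n) (\<lambda>x. u x * w x) z
      = (deriv ^^ n) (\<lambda>x. deriv u x * w x + u x * deriv w x) z"
  proof (rule higher_deriv_Suc_ev)
    show "\<forall>\<^sub>F x in nhds z. ((\<lambda>x. u x * w x) has_real_derivative
        (deriv u x * w x + u x * deriv w x)) (at x)"
      using Suc.prems(1,2)[THEN smooth_near_SucD(1)]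
      by eventually_elim (auto intro!: derivative_eq_intros)
  qed
  also have "\<dots> = (deriv ^^ n) (\<lambda>x. deriv u x * w x) z + (deriv ^^ n) (\<lambda>x. u x * deriv w x) z"
    using sm by (intro higher_deriv_add smooth_near_mult)
  also have "(deriv ^^ n) (\<lambda>x. deriv u x * w x) z = (deriv ^^ n) (deriv u) z * w z"
    using sm Suc.prems(3) by (intro Suc.IH) auto
  also have "(deriv ^^ n) (\<lambda>x. u x * deriv w x) z = (deriv ^^ n) u z * deriv w z"
    using sm w' by (intro Suc.IH) auto
  also have "deriv w z = 0" using w'[of 0] by simp
  finally show ?case by (simp add: funpow_Suc_right del: funpow.simps(2))
qed simp

text \<open>A constant is a flat factor.\<close>

lemma higher_deriv_cmult:
  assumes "smooth_near n u z"
  shows "(deriv ^^ n) (\<lambda>x. c * u x) z = c * (deriv ^^ n) u z"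
  using higher_deriv_mult_flat[OF assms smooth_near_const[of n c z]]
  by (simp add: higher_deriv_const mult.commute)

lemma higher_deriv_sum:
  "finite I \<Longrightarrow> (\<And>i. i \<in> I \<Longrightarrow> smooth_near n (u i) z) \<Longrightarrow>
     (deriv ^^ n) (\<lambda>x. \<Sum>i\<in>I. u i x) z = (\<Sum>i\<in>I. (deriv ^^ n) (u i) z)"
  by (induction rule: finite_induct)
    (auto simp: higher_deriv_const higher_deriv_add smooth_near_sum)

text \<open>
  Only the term with the n-th power of g' survives in the formula of Faa di Bruno.
\<close>

lemma higher_deriv_compose_flat:
  "smooth_near n F (g z) \<Longrightarrow> smooth_near n g z \<Longrightarrow> (\<And>j. j \<in> {2..n} \<Longrightarrow> (deriv ^^ j) g z = 0) \<Longrightarrow>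
     (deriv ^^ n) (\<lambda>x. F (g x)) z = (deriv ^^ n) F (g z) * deriv g z ^ n"
proof (induction n arbitrary: F)
  case (Suc n)
  have sm: "smooth_near n g z" "smooth_near n (deriv F) (g z)" "smooth_near n (deriv g) z"
    using Suc.prems smooth_near_Suc_imp[of n] by (simp_all add: smooth_near_Suc)
  have g': "(deriv ^^ j) (deriv g) z = 0" if "j \<in> {1..n}" for j
    using Suc.prems(3)[of "Suc j"] that by (simp add: funpow_Suc_right del: funpow.simps(2))
  have "filterlim g (nhds (g z)) (nhds z)"
    using smooth_near_isCont[OF sm(1)] by (simp add: isCont_def tendsto_at_iff_tendsto_nhds)
  then have "\<forall>\<^sub>F x in nhds z. (F has_real_derivative deriv F (g x)) (at (g x))"
    using Suc.prems(1) by (auto simp: smooth_near_Suc filterlim_iff)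
  then have "\<forall>\<^sub>F x in nhds z. ((\<lambda>x. F (g x)) has_real_derivative deriv F (g x) * deriv g x) (at x)"
    using smooth_near_SucD(1)[OF Suc.prems(2)] by eventually_elim (rule DERIV_chain2)
  then have "(deriv ^^ Suc n) (\<lambda>x. F (g x)) z = (deriv ^^ n) (\<lambda>x. deriv F (g x) * deriv g x) z"
    by (rule higher_deriv_Suc_ev)
  \<comment> \<open>All derivatives of \<open>deriv g\<close> of orders 1 to \<open>n\<close> vanish
    at \<open>z\<close>, so it leaves the n-th derivative like a constant. Each induction step
    yields one such factor.\<close>
  also have "\<dots> = (deriv ^^ n) (\<lambda>x. deriv F (g x)) z * deriv g z"
    using smooth_near_compose[OF sm(2,1)] sm(3) g' by (rule higher_deriv_mult_flat)
  also have "(deriv ^^ n) (\<lambda>x. deriv F (g x)) z = (deriv ^^ n) (deriv F) (g z) * deriv g z ^ n"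
    using sm(2,1) by (rule Suc.IH) (use Suc.prems(3) in auto)
  finally show ?case by (simp add: funpow_Suc_right mult_ac del: funpow.simps(2))
qed simp

section \<open>Taylor remainder\<close>

text \<open>Lagrange's remainder involves the n-th derivative at an intermediate point; being
  continuous, that derivative is bounded on a compact ball around \<open>z\<close>.\<close>

lemma smooth_near_taylor:
  assumes "smooth_near n g z" and "n > 0"
  shows "(\<lambda>x. g x - (\<Sum>m<n. (deriv ^^ m) g z / fact m * (x - z) ^ m)) \<in> O[at z](\<lambda>x. (x - z) ^ n)"
proof -
  from assms(1) obtain S where S: "open S" "z \<in> S"
    and diff: "\<And>i x. i < n \<Longrightarrow> x \<in> S \<Longrightarrow> (deriv ^^ i) g differentiable (at x)"
    and cont: "continuous_on S ((deriv ^^ n) g)"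
    unfolding smooth_near_def by blast
  from S obtain e where e: "e > 0" "cball z e \<subseteq> S"
    by (auto simp: open_contains_cball)
  have "bounded ((deriv ^^ n) g ` cball z e)"
    using cont e by (intro compact_imp_bounded compact_continuous_image) (auto intro: continuous_on_subset)
  then obtain B where B: "\<forall>x\<in>cball z e. \<bar>(deriv ^^ n) g x\<bar> \<le> B"
    unfolding bounded_iff by (auto simp del: mem_cball)
  have "\<forall>\<^sub>F x in at z. x \<in> cball z e"
    using e by (intro eventually_at_in_open'[of "ball z e", THEN eventually_mono]) auto
  then have "\<forall>\<^sub>F x in at z. norm (g x - (\<Sum>m<n. (deriv ^^ m) g z / fact m * (x - z) ^ m))
      \<le> B / fact n * norm ((x - z) ^ n)"
    using eventually_neq_at_within[of z z UNIV]
  proof eventually_elim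
    case (elim x)
    have D: "((deriv ^^ m) g has_real_derivative (deriv ^^ Suc m) g t) (at t)"
      if "m < n" "z - e \<le> t" "t \<le> z + e" for m t
    proof -
      have "t \<in> S" using e that by (auto simp: dist_real_def subset_iff)
      then show ?thesis
        using diff[of m t] that by (simp add: DERIV_deriv_iff_real_differentiable)
    qed
    \<comment> \<open>The intermediate point lies strictly between \<open>x\<close> and
      \<open>z\<close>, which is why \<open>x = z\<close> was excluded beforehand.\<close>
    have "\<exists>t. (if x < z then x < t \<and> t < z else z < t \<and> t < x) \<and>
        g x = (\<Sum>m<n. (deriv ^^ m) g z / fact m * (x - z) ^ m)
               + (deriv ^^ n) g t / fact n * (x - z) ^ n"
      by (rule Taylor[of n "\<lambda>m. (deriv ^^ m) g" g "z - e" "z + e" z x])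
        (use assms(2) D e elim in \<open>auto simp: dist_real_def\<close>)
    then obtain t where t: "if x < z then x < t \<and> t < z else z < t \<and> t < x"
      and gx: "g x = (\<Sum>m<n. (deriv ^^ m) g z / fact m * (x - z) ^ m)
               + (deriv ^^ n) g t / fact n * (x - z) ^ n"
      by blast
    have "t \<in> cball z e" using t elim by (auto simp: dist_real_def split: if_splits)
    with B have "\<bar>(deriv ^^ n) g t\<bar> \<le> B" by blast
    then show ?case
      unfolding gx by (simp add: abs_mult divide_right_mono mult_right_mono)
  qed
  then show ?thesis by (rule bigoI)
qed

section \<open>The Vandermonde system\<close>

text \<open>By linearity, vanishing moments make the weighted sum of the values of any polynomial of
  degree below \<open>card I\<close> vanish. This is the nonsingularity of a Vandermonde matrix,
  obtained without its determinant formula.\<close>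

lemma power_moments_eq_0:
  fixes c x :: "'b \<Rightarrow> 'a :: field"
  assumes "finite I" and "inj_on x I"
    and moments: "\<And>r. r < card I \<Longrightarrow> (\<Sum>i\<in>I. c i * x i ^ r) = 0" and "j \<in> I"
  shows "c j = 0"
proof -
  \<comment> \<open>The Lagrange polynomial for the node x j isolates the coefficient c j.\<close>
  define p where "p = (\<Prod>i\<in>I - {j}. [:- x i, 1:])"
  \<comment> \<open>One linear factor for each node other than \<open>x j\<close>, so the degree
    stays within the range of the known moments.\<close>
  have "degree p \<le> card (I - {j})"
    unfolding p_def using degree_prod_sum_le[of "I - {j}" "\<lambda>i. [:- x i, 1:]"] assms(1) by simp
  then have deg: "degree p < card I"
    using assms(1,4) by (metis card_Diff1_less order.strict_trans1)
  have "(\<Sum>i\<in>I. c i * poly p (x i)) = (\<Sum>r\<le>degree p. coeff p r * (\<Sum>i\<in>I. c i * x i ^ r))"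
    unfolding poly_altdef sum_distrib_left by (subst sum.swap) (simp add: mult_ac)
  also have "\<dots> = 0" using deg moments by (intro sum.neutral) auto
  finally have "(\<Sum>i\<in>I. c i * poly p (x i)) = 0" .
  moreover have "poly p (x i) = 0" if "i \<in> I - {j}" for i
    using that assms(1) by (auto simp: p_def poly_prod)
  ultimately have "c j * poly p (x j) = 0"
    using assms(1,4) by (simp add: sum.remove)
  moreover have "poly p (x j) \<noteq> 0"
    using assms by (auto simp: p_def poly_prod inj_on_def)
  ultimately show ?thesis by simp
qed

lemma R_mat_carrier [simp]: "R_mat k \<in> carrier_mat (k + 1) (k + 1)"
  by (simp add: R_mat_def)

lemma R_mat_mult_vec:
  assumes "c \<in> carrier_vec (k + 1)" and "r < k + 1"
  shows "(R_mat k *\<^sub>v c) $ r = (\<Sum>i<k + 1. c $ i * (1 - real i) ^ r)"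
  using assms by (auto simp: R_mat_def scalar_prod_def lessThan_atLeast0 mult.commute intro!: sum.cong)

text \<open>The nodes \<open>1 - real i\<close> are distinct. The hypothesis is entrywise because
  the linear independence proof obtains one entry from each derivative.\<close>

lemma R_mat_inj:
  assumes "c \<in> carrier_vec (k + 1)" and "\<And>r. r < k + 1 \<Longrightarrow> (R_mat k *\<^sub>v c) $ r = 0"
  shows "c = 0\<^sub>v (k + 1)"
proof (rule eq_vecI)
  fix j assume "j < dim_vec (0\<^sub>v (k + 1) :: real vec)"
  then have j: "j < k + 1" by simp
  have "c $ j = 0"
    by (rule power_moments_eq_0[of "{..<k + 1}" "\<lambda>i. 1 - real i" "($) c"])
      (use j assms R_mat_mult_vec in \<open>auto simp: inj_on_def\<close>)
  with j show "c $ j = 0\<^sub>v (k + 1) $ j" by simp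
qed (use assms in auto)

text \<open>A trivial kernel gives a nonzero determinant, hence a two-sided inverse
  \<open>B\<close>: one side yields existence, the other uniqueness.\<close>

lemma ex1_R_mat_solution:
  assumes "b \<in> carrier_vec (k + 1)"
  shows "\<exists>!s. s \<in> carrier_vec (k + 1) \<and> R_mat k *\<^sub>v s = b"
proof -
  have "det (R_mat k) \<noteq> 0"
    unfolding det_0_iff_vec_prod_zero_field[OF R_mat_carrier] using R_mat_inj[of _ k] by auto
  then have "R_mat k \<in> Units (ring_mat TYPE(real) (k + 1) ())"
    by (intro det_non_zero_imp_unit R_mat_carrier)
  then obtain B where B: "B \<in> carrier_mat (k + 1) (k + 1)"
    "R_mat k * B = 1\<^sub>m (k + 1)" "B * R_mat k = 1\<^sub>m (k + 1)"
    by (auto simp: Units_def ring_mat_simps)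
  show ?thesis
  proof (rule ex1I[of _ "B *\<^sub>v b"])
    show "B *\<^sub>v b \<in> carrier_vec (k + 1) \<and> R_mat k *\<^sub>v (B *\<^sub>v b) = b"
      using B assms assoc_mult_mat_vec[OF R_mat_carrier B(1) assms] by auto
    show "s = B *\<^sub>v b" if "s \<in> carrier_vec (k + 1) \<and> R_mat k *\<^sub>v s = b" for s
      using that B assoc_mult_mat_vec[OF B(1) R_mat_carrier, of s] by auto
  qed
qed

section \<open>Derivatives of the shifted functions and of their combinations\<close>

lemma smooth_near_shifted_deriv:
  assumes "smooth_near (k + 2) f z" and "step_function k h z"
  shows "smooth_near (k + 1) (\<lambda>x. deriv f (x + real i * h x)) z"
proof (rule smooth_near_compose[where F = "deriv f"])
  \<comment> \<open>Since \<open>h z = 0\<close>, the inner map fixes \<open>z\<close>, and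
    smoothness of \<open>deriv f\<close> at \<open>z\<close> itself suffices.\<close>
  show "smooth_near (k + 1) (deriv f) (z + real i * h z)"
    using assms by (simp add: smooth_near_Suc step_function_def)
  show "smooth_near (k + 1) (\<lambda>x. x + real i * h x) z"
    using assms by (intro smooth_near_add smooth_near_mult smooth_near_ident smooth_near_const)
      (simp add: step_function_def)
qed

text \<open>The flat chain rule applies to the inner map, which has slope \<open>1 - real i\<close>
  at \<open>z\<close>. For \<open>i = 1\<close> the slope is 0, and \<open>0 ^ 0 = 1\<close> gives
  the correct value at order 0.\<close>

lemma higher_deriv_shifted_deriv:
  assumes f: "smooth_near (k + 2) f z" and h: "step_function k h z" and "r \<le> k"
  shows "(deriv ^^ r) (\<lambda>x. deriv f (x + real i * h x)) z = (deriv ^^ (r + 1)) f z * (1 - real i) ^ r"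
proof -
  define g where "g = (\<lambda>x. x + real i * h x)"
  have h': "h z = 0" "deriv h z = -1" "\<And>j. j \<in> {2..k} \<Longrightarrow> (deriv ^^ j) h z = 0"
    using h by (auto simp: step_function_def)
  have sh: "smooth_near m h z" if "m \<le> k + 1" for m
    using h that smooth_near_mono[of "k + 1" h z m] by (simp add: step_function_def)
  have sg: "smooth_near m g z" if "m \<le> k + 1" for m
    unfolding g_def using sh[OF that]
    by (intro smooth_near_add smooth_near_mult smooth_near_ident smooth_near_const)
  have ident: "(deriv ^^ j) (\<lambda>x. x) z = (if j = 0 then z else if j = 1 then 1 else 0)" for j
    by (cases j) (auto simp: funpow_Suc_right higher_deriv_const simp del: funpow.simps(2))
  have dg: "(deriv ^^ j) g z = (deriv ^^ j) (\<lambda>x. x) z + real i * (deriv ^^ j) h z"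
    if "j \<le> k + 1" for j
    unfolding g_def using sh[OF that]
    by (simp add: higher_deriv_add higher_deriv_cmult smooth_near_mult smooth_near_ident
        smooth_near_const)
  have gz: "g z = z" using h' by (simp add: g_def)
  have "(deriv ^^ r) (\<lambda>x. deriv f (g x)) z = (deriv ^^ r) (deriv f) (g z) * deriv g z ^ r"
  proof (rule higher_deriv_compose_flat)
    have "smooth_near (k + 1) (deriv f) z" using f by (simp add: smooth_near_Suc)
    then show "smooth_near r (deriv f) (g z)"
      unfolding gz by (rule smooth_near_mono) (use \<open>r \<le> k\<close> in simp)
  qed (use \<open>r \<le> k\<close> h' sg dg in \<open>auto simp: ident\<close>)
  moreover have "deriv g z = 1 - real i" using dg[of 1] h' by (simp add: ident)
  ultimately have "(deriv ^^ r) (\<lambda>x. deriv f (g x)) z = (deriv ^^ (r + 1)) f z * (1 - real i) ^ r"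
    by (simp add: gz funpow_Suc_right del: funpow.simps(2))
  then show ?thesis by (simp only: g_def)
qed

lemma phi_const:
  assumes "c \<in> carrier_vec (k + 1)"
  shows "phi f h k (\<lambda>x. c) = (\<lambda>x. \<Sum>i<k + 1. c $ i * deriv f (x + real i * h x))"
  using assms by (auto simp: phi_def V_vec_def scalar_prod_def lessThan_atLeast0 intro!: ext sum.cong)

lemma smooth_near_phi:
  assumes "smooth_near (k + 2) f z" and "step_function k h z" and "c \<in> carrier_vec (k + 1)"
  shows "smooth_near (k + 1) (phi f h k (\<lambda>x. c)) z"
  unfolding phi_const[OF assms(3)]
  using smooth_near_shifted_deriv[OF assms(1,2)]
  by (intro smooth_near_sum smooth_near_mult smooth_near_const) auto

text \<open>The derivative of \<open>f\<close> is common to all summands, and what remains is row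
  \<open>r\<close> of the system. Both directions of the model criterion and the linear independence
  rest on this.\<close>

lemma higher_deriv_phi:
  assumes "smooth_near (k + 2) f z" and "step_function k h z" and "c \<in> carrier_vec (k + 1)"
    and "r \<le> k"
  shows "(deriv ^^ r) (phi f h k (\<lambda>x. c)) z = (deriv ^^ (r + 1)) f z * (R_mat k *\<^sub>v c) $ r"
proof -
  have sm: "smooth_near r (\<lambda>x. deriv f (x + real i * h x)) z" for i
    using smooth_near_mono[OF smooth_near_shifted_deriv[OF assms(1,2)]] \<open>r \<le> k\<close> by simp
  have "(deriv ^^ r) (phi f h k (\<lambda>x. c)) z
      = (\<Sum>i<k + 1. (deriv ^^ r) (\<lambda>x. c $ i * deriv f (x + real i * h x)) z)"
    unfolding phi_const[OF assms(3)]
    by (intro higher_deriv_sum smooth_near_mult smooth_near_const sm) auto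
  also have "\<dots> = (\<Sum>i<k + 1. c $ i * ((deriv ^^ (r + 1)) f z * (1 - real i) ^ r))"
    using higher_deriv_cmult[OF sm] higher_deriv_shifted_deriv[OF assms(1,2,4)] by simp
  also have "\<dots> = (deriv ^^ (r + 1)) f z * (R_mat k *\<^sub>v c) $ r"
    using assms(3,4) by (simp only: R_mat_mult_vec[of c k r] sum_distrib_left mult_ac)
  finally show ?thesis .
qed

section \<open>Order of convergence\<close>

lemma model_function_convergence_order:
  assumes zero: "simple_zero f z" and f: "smooth_near (k + 2) f z"
    and model: "model_function k f \<phi> z"
  shows "convergence_order_at_least (\<lambda>x. x - inverse (\<phi> x) * f x) z (k + 2)"
proof -
  have fz: "f z = 0" "deriv f z \<noteq> 0" using zero by (auto simp: simple_zero_def)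
  have \<phi>: "smooth_near (k + 1) \<phi> z"
    "\<And>m. m \<le> k \<Longrightarrow> (deriv ^^ m) \<phi> z = (deriv ^^ (m + 1)) f z / real (m + 1)"
    using model by (auto simp: model_function_def)
  define P where "P = (\<lambda>x. \<Sum>m<k + 1. (deriv ^^ m) \<phi> z / fact m * (x - z) ^ m)"
  define Q where "Q = (\<lambda>x. \<Sum>m<k + 2. (deriv ^^ m) f z / fact m * (x - z) ^ m)"
  have PQ: "Q x = (x - z) * P x" for x
  proof -
    \<comment> \<open>The constant term drops out because \<open>f z = 0\<close>. After the shift,
      \<open>fact (Suc m) = (m + 1) * fact m\<close> turns the model condition into equality of
      coefficients.\<close>
    have "Q x = (\<Sum>m<k + 1. (deriv ^^ Suc m) f z / fact (Suc m) * (x - z) ^ Suc m)"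
      unfolding Q_def add_2_eq_Suc' by (subst sum.lessThan_Suc_shift) (simp add: fz)
    also have "\<dots> = (\<Sum>m<k + 1. (x - z) * ((deriv ^^ m) \<phi> z / fact m * (x - z) ^ m))"
      using \<phi>(2) by (intro sum.cong refl) (simp del: funpow.simps add: mult_ac)
    finally show ?thesis by (simp only: P_def sum_distrib_left)
  qed
  \<comment> \<open>The factor \<open>x - z\<close> raises the remainder of \<open>\<phi>\<close>
    from order \<open>k + 1\<close> to the order \<open>k + 2\<close> of the remainder of
    \<open>f\<close>.\<close>
  have "(\<lambda>x. (x - z) * (\<phi> x - P x)) \<in> O[at z](\<lambda>x. (x - z) ^ (k + 2))"
    using landau_o.big.mult[OF landau_o.big_refl[of "\<lambda>x. x - z"] smooth_near_taylor[OF \<phi>(1)]]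
    by (simp add: P_def del: sum.lessThan_Suc)
  moreover have "(\<lambda>x. f x - Q x) \<in> O[at z](\<lambda>x. (x - z) ^ (k + 2))"
    unfolding Q_def by (rule smooth_near_taylor[OF f]) simp
  ultimately have "(\<lambda>x. (x - z) * (\<phi> x - P x) - (f x - Q x)) \<in> O[at z](\<lambda>x. (x - z) ^ (k + 2))"
    by (rule sum_in_bigo(2))
  then have num: "(\<lambda>x. (x - z) * \<phi> x - f x) \<in> O[at z](\<lambda>x. (x - z) ^ (k + 2))"
    by (simp add: PQ right_diff_distrib)
  \<comment> \<open>The model condition of order 0 reads \<open>\<phi> z = deriv f z\<close>,
    nonzero at a simple zero; hence the reciprocal is bounded near \<open>z\<close>.\<close>
  have \<phi>z: "\<phi> z \<noteq> 0" using \<phi>(2)[of 0] fz by simp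
  have lim: "(\<phi> \<longlongrightarrow> \<phi> z) (at z)"
    using smooth_near_isCont[OF \<phi>(1)] by (simp add: isCont_def)
  have "((\<lambda>x. inverse (\<phi> x)) \<longlongrightarrow> inverse (\<phi> z)) (at z)"
    using lim \<phi>z by (rule tendsto_inverse)
  then have "(\<lambda>x. inverse (\<phi> x)) \<in> O[at z](\<lambda>x. 1)"
    by (intro bigoI_tendsto[where c = "inverse (\<phi> z)"]) auto
  from landau_o.big.mult[OF this num]
  have "(\<lambda>x. inverse (\<phi> x) * ((x - z) * \<phi> x - f x)) \<in> O[at z](\<lambda>x. (x - z) ^ (k + 2))"
    by simp
  \<comment> \<open>Only eventual, since the cancellation requires \<open>\<phi> x\<close> to be
    nonzero (\<open>inverse 0 = 0\<close>).\<close>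
  moreover have "\<forall>\<^sub>F x in at z.
      inverse (\<phi> x) * ((x - z) * \<phi> x - f x) = x - inverse (\<phi> x) * f x - z"
    using tendsto_imp_eventually_ne[OF lim \<phi>z] by eventually_elim (simp add: field_simps)
  ultimately have "(\<lambda>x. x - inverse (\<phi> x) * f x - z) \<in> O[at z](\<lambda>x. (x - z) ^ (k + 2))"
    by (subst (asm) landau_o.big.in_cong) auto
  then have "(\<lambda>x. \<bar>x - inverse (\<phi> x) * f x - z\<bar>) \<in> O[at z](\<lambda>x. \<bar>x - z\<bar> ^ (k + 2))"
    by (simp only: power_abs[symmetric] landau_o.big.abs landau_o.big.abs_in_iff)
  then show ?thesis
    unfolding convergence_order_at_least_def using fz by simp
qed

theorem proposition2p3:
  fixes D :: "real set" and f h :: "real \<Rightarrow> real" and z :: real and k :: nat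
    and U :: "real \<Rightarrow> real vec" and a :: "real vec"
  assumes "open D" and "z \<in> D"
    and "simple_zero f z" and "smooth_near (k + 2) f z"
    and "step_function k h z"
    and "a \<in> carrier_vec (k + 1)" and "U = (\<lambda>x. a)"
  shows
    "mat_of_rows (k + 1) (map (\<lambda>r. vec_deriv r (V_vec f h k) z) [0..<k + 1])
       = D_mat f z k * R_mat k
     \<and> (\<exists>!s. s \<in> carrier_vec (k + 1) \<and> R_mat k *\<^sub>v s = b_vec k)
     \<and> (R_mat k *\<^sub>v a = b_vec k \<longrightarrow> model_function k f (phi f h k U) z)
     \<and> ((\<forall>i\<in>{1..k + 1}. (deriv ^^ i) f z \<noteq> 0) \<longrightarrow>
          model_function k f (phi f h k U) z \<longrightarrow> R_mat k *\<^sub>v a = b_vec k)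
     \<and> (R_mat k *\<^sub>v a = b_vec k \<longrightarrow> (\<Sum>i=0..k. a $ i) = 1)
     \<and> ((\<forall>i\<in>{1..k + 1}. (deriv ^^ i) f z \<noteq> 0) \<longrightarrow>
          model_function k f (phi f h k U) z \<longrightarrow>
          barycentric_coordinates a (phi f h k U) (V_vec f h k) (k + 1) z)
     \<and> (R_mat k *\<^sub>v a = b_vec k \<longrightarrow>
          convergence_order_at_least (\<lambda>x. x - inverse (phi f h k U x) * f x) z (k + 2))"
proof (intro conjI impI)
  note f = \<open>smooth_near (k + 2) f z\<close> and h = \<open>step_function k h z\<close>
    and a = \<open>a \<in> carrier_vec (k + 1)\<close>
  have U: "phi f h k U = phi f h k (\<lambda>x. a)" using \<open>U = (\<lambda>x. a)\<close> by simp
  show "mat_of_rows (k + 1) (map (\<lambda>r. vec_deriv r (V_vec f h k) z) [0..<k + 1])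
      = D_mat f z k * R_mat k"
  proof (rule eq_matI)
    fix r i assume "r < dim_row (D_mat f z k * R_mat k)" "i < dim_col (D_mat f z k * R_mat k)"
    then have ri: "r < k + 1" "i < k + 1" by (auto simp: D_mat_def R_mat_def mat_diag_def)
    have "(deriv ^^ r) (\<lambda>y. V_vec f h k y $ i) z = (deriv ^^ (r + 1)) f z * (1 - real i) ^ r"
      using ri higher_deriv_shifted_deriv[OF f h, of r i] by (simp add: V_vec_def)
    moreover have "(D_mat f z k * R_mat k) $$ (r, i) = (deriv ^^ (r + 1)) f z * (1 - real i) ^ r"
      unfolding D_mat_def mat_diag_mult_left[OF R_mat_carrier] using ri by (simp add: R_mat_def)
    ultimately show "mat_of_rows (k + 1) (map (\<lambda>r. vec_deriv r (V_vec f h k) z) [0..<k + 1]) $$ (r, i)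
        = (D_mat f z k * R_mat k) $$ (r, i)"
      using ri by (simp add: mat_of_rows_index vec_deriv_def V_vec_def del: upt_Suc)
  qed (auto simp: D_mat_def R_mat_def mat_diag_def)
  show "\<exists>!s. s \<in> carrier_vec (k + 1) \<and> R_mat k *\<^sub>v s = b_vec k"
    by (rule ex1_R_mat_solution) (simp add: b_vec_def)
  show model: "model_function k f (phi f h k U) z" if "R_mat k *\<^sub>v a = b_vec k"
    unfolding model_function_def U
    using smooth_near_phi[OF f h a] higher_deriv_phi[OF f h a] that by (auto simp: b_vec_def)
  show sol: "R_mat k *\<^sub>v a = b_vec k"
    if nz: "\<forall>i\<in>{1..k + 1}. (deriv ^^ i) f z \<noteq> 0" and m: "model_function k f (phi f h k U) z"
  proof (rule eq_vecI)
    fix r assume "r < dim_vec (b_vec k)"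
    then have r: "r \<le> k" by (simp add: b_vec_def)
    then have "(deriv ^^ (r + 1)) f z * (R_mat k *\<^sub>v a) $ r = (deriv ^^ (r + 1)) f z / real (r + 1)"
      using m higher_deriv_phi[OF f h a r] unfolding model_function_def U by metis
    \<comment> \<open>If this derivative vanished, the preceding equation would read 0 = 0 and say
      nothing about row \<open>r\<close>.\<close>
    moreover have "(deriv ^^ (r + 1)) f z \<noteq> 0" using bspec[OF nz, of "r + 1"] r by simp
    ultimately have "(R_mat k *\<^sub>v a) $ r = 1 / real (r + 1)"
      by (metis divide_inverse inverse_eq_divide mult_left_cancel)
    then show "(R_mat k *\<^sub>v a) $ r = b_vec k $ r"
      using r by (simp add: b_vec_def)
  qed (simp add: R_mat_def b_vec_def)
  \<comment> \<open>Row 0 of \<open>R_mat k\<close> consists of ones, also at \<open>i = 1\<close>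
    by \<open>0 ^ 0 = 1\<close>, and \<open>b_vec k\<close> starts with 1: the first equation is the
    normalisation.\<close>
  show sum: "(\<Sum>i=0..k. a $ i) = 1" if "R_mat k *\<^sub>v a = b_vec k"
    using R_mat_mult_vec[OF a, of 0] that
    by (simp add: b_vec_def atLeast0AtMost lessThan_Suc_atMost)
  show "barycentric_coordinates a (phi f h k U) (V_vec f h k) (k + 1) z"
    if nz: "\<forall>i\<in>{1..k + 1}. (deriv ^^ i) f z \<noteq> 0" and m: "model_function k f (phi f h k U) z"
    unfolding barycentric_coordinates_def
  proof (intro conjI a)
    have V: "phi f h k (\<lambda>x. c) x = (\<Sum>i<k + 1. c $ i * V_vec f h k x $ i)"
      if "c \<in> carrier_vec (k + 1)" for c x
      using phi_const[OF that] by (simp add: V_vec_def)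
    show "lin_indep_near (V_vec f h k) (k + 1) z"
      unfolding lin_indep_near_def
    proof (intro ballI impI)
      fix c :: "real vec"
      assume c: "c \<in> carrier_vec (k + 1)"
        and "\<forall>\<^sub>F x in nhds z. (\<Sum>i<k + 1. c $ i * V_vec f h k x $ i) = 0"
      then have ev: "\<forall>\<^sub>F x in nhds z. phi f h k (\<lambda>x. c) x = 0"
        by (simp add: V)
      show "c = 0\<^sub>v (k + 1)"
      proof (rule R_mat_inj[OF c])
        fix r assume "r < k + 1"
        then have r: "r \<le> k" by simp
        \<comment> \<open>The relation holds near \<open>z\<close>, so it may be differentiated
          there; orders 0 to \<open>k\<close> give \<open>k + 1\<close> equations, which force
          \<open>R_mat k *\<^sub>v c\<close> to vanish.\<close>
        have "(deriv ^^ r) (phi f h k (\<lambda>x. c)) z = (deriv ^^ r) (\<lambda>x. 0) z"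
          using ev by (rule higher_deriv_cong_ev) simp
        then have "(deriv ^^ (r + 1)) f z * (R_mat k *\<^sub>v c) $ r = 0"
          using higher_deriv_phi[OF f h c r] by (simp add: higher_deriv_const)
        moreover have "(deriv ^^ (r + 1)) f z \<noteq> 0" using bspec[OF nz, of "r + 1"] r by simp
        ultimately show "(R_mat k *\<^sub>v c) $ r = 0" by simp
      qed
    qed
    show "\<forall>\<^sub>F x in nhds z. phi f h k U x = (\<Sum>i<k + 1. a $ i * V_vec f h k x $ i)"
      unfolding U by (simp add: V[OF a])
    show "(\<Sum>i<k + 1. a $ i) = 1"
      using sum[OF sol[OF nz m]] by (simp add: atLeast0AtMost lessThan_Suc_atMost)
  qed
  show "convergence_order_at_least (\<lambda>x. x - inverse (phi f h k U x) * f x) z (k + 2)"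
    if "R_mat k *\<^sub>v a = b_vec k"
    using \<open>simple_zero f z\<close> f model[OF that] by (rule model_function_convergence_order)
qed

end
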